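(* For all integers $r \ge 2$ and $a \ge r+2$, $[\mathcal{K}_r(a)] = \{J_r(a,t) : 0 \le t \le \lfloor r/2 \rfloor\}$; that is, a graph $H$ satisfies $D(H,x) = D(\mathcal{K}_r(a),x)$ if and only if $H \cong J_r(a,t)$ for some integer $t$ with $0 \le t \le \lfloor r/2 \rfloor$.
   Context: All graphs are finite and simple, and $\mathbb{N}$ denotes the positive integers. For a graph $G=(V,E)$, $v(G)=|V|$, and $N[v]$ denotes the closed neighborhood of a vertex $v$ (i.e. $v$ together with all its neighbors). A set $S \subseteq V$ is a dominating set of $G$ if $\bigcup_{x\in S} N[x] = V$. Let $d(G,i)$ be the number of dominating sets of $G$ of cardinality $i$. The domination polynomial of $G$ is $D(G,x)=\sum_{i=1}^{v(G)} d(G,i)\, x^i$. Two graphs $G,H$ are $\mathcal{D}$-equivalent if $D(G,x)=D(H,x)$, and $[G]$ denotes the $\mathcal{D}$-equivalence class of $G$, with graphs considered up to isomorphism. For $r \in \mathbb{N}$ and $a\in\mathbb{N}$, $\mathcal{K}_r(a)$ denotes the complete $r$-partite graph all of whose $r$ color classes have size $a$; $\mathcal{K}_1(a)$ is the graph on $a$ vertices with no edges, and $\mathcal{K}_0(a)$ is defined to be the empty graph $\mathcal{E}$ with no vertices and no edges. For vertex-disjoint graphs $G$ and $H$, the join $G\vee H$ is the union of $G$ and $H$ together with all edges between $V(G)$ and $V(H)$ (so $G \vee \mathcal{E} = G$); the join $\bigvee_{i=1}^k G_i = G_1\vee\cdots\vee G_k$ of several vertex-disjoint graphs is defined analogously (an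 empty join being $\mathcal{E}$). For $a \in\mathbb{N}$, $H_0(a)$ is the graph on $2a$ vertices formed by two disjoint copies of the complete graph $K_a$ connected by a perfect matching between them (equivalently, the Cartesian product of $K_a$ and $K_2$). For $r\ge 2$ and $0\le t\le \lfloor r/2\rfloor$, $J_r(a,t)$ is the graph on $a\cdot r$ vertices given by $J_r(a,t) = \left(\bigvee_{i=1}^t H_i\right)\vee \mathcal{K}_{r-2t}(a)$, where $H_1,\ldots,H_t$ are vertex-disjoint copies of $H_0(a)$; in particular $J_r(a,0)=\mathcal{K}_r(a)$. *)

theory Defs
  imports
    "Graph_Theory.Pair_Digraph"
    "Graph_Theory.Digraph_Isomorphism"
    "HOL-Computational_Algebra.Polynomial"
begin

(* A finite simple graph is a pair_graph: a finite vertex set together with a symmetric,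
   irreflexive arc relation on it, an edge {u,v} being the two arcs (u,v) and (v,u).
   The graph without vertices is a pair_graph. *)

abbreviation graph_iso :: "'a pair_pre_digraph \<Rightarrow> 'b pair_pre_digraph \<Rightarrow> bool"
    (infix \<open>\<simeq>\<^sub>G\<close> 50) where
  "G \<simeq>\<^sub>G H \<equiv> digraph_iso (with_proj G) (with_proj H)"


section \<open>Domination\<close>

definition closed_nbhd :: "'a pair_pre_digraph \<Rightarrow> 'a \<Rightarrow> 'a set" where
  "closed_nbhd G v = insert v {u. (v, u) \<in> parcs G}"

definition dominating_set :: "'a pair_pre_digraph \<Rightarrow> 'a set \<Rightarrow> bool" where
  "dominating_set G S \<longleftrightarrow> S \<subseteq> pverts G \<and> (\<Union>x\<in>S. closed_nbhd G x) = pverts G"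

definition num_dominating :: "'a pair_pre_digraph \<Rightarrow> nat \<Rightarrow> nat" where
  "num_dominating G i = card {S. dominating_set G S \<and> card S = i}"

definition domination_poly :: "'a pair_pre_digraph \<Rightarrow> int poly" where
  "domination_poly G = (\<Sum>i = 1..card (pverts G). monom (int (num_dominating G i)) i)"


section \<open>Joins\<close>

(* The vertex sets of the graphs to be joined are made disjoint by tagging. *)

definition join :: "'a pair_pre_digraph \<Rightarrow> 'b pair_pre_digraph \<Rightarrow> ('a + 'b) pair_pre_digraph" where
  "join G H = \<lparr> pverts = pverts G <+> pverts H,
     parcs = {(Inl u, Inl v) | u v. (u, v) \<in> parcs G}
           \<union> {(Inr u, Inr v) | u v. (u, v) \<in> parcs H}
           \<union> {(Inl u, Inr v) | u v. u \<in> pverts G \<and> v \<in> pverts H}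
           \<union> {(Inr v, Inl u) | u v. u \<in> pverts G \<and> v \<in> pverts H} \<rparr>"

definition join_family ::
    "'i set \<Rightarrow> ('i \<Rightarrow> 'a pair_pre_digraph) \<Rightarrow> ('i \<times> 'a) pair_pre_digraph" where
  "join_family I G = \<lparr> pverts = (SIGMA i:I. pverts (G i)),
     parcs = {((i, u), (i, v)) | i u v. i \<in> I \<and> (u, v) \<in> parcs (G i)}
           \<union> {((i, u), (j, v)) | i j u v.
                i \<in> I \<and> j \<in> I \<and> i \<noteq> j \<and> u \<in> pverts (G i) \<and> v \<in> pverts (G j)} \<rparr>"


section \<open>The graphs of the theorem\<close>

(* The vertex (i, x) is the x-th vertex of colour class i. *)

definition complete_multipartite :: "nat \<Rightarrow> nat \<Rightarrow> (nat \<times> nat) pair_pre_digraph"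
    (\<open>\<K>\<close>) where
  "\<K> r a = \<lparr> pverts = {..<r} \<times> {..<a},
     parcs = {((i, x), (j, y)) | i x j y. i < r \<and> j < r \<and> x < a \<and> y < a \<and> i \<noteq> j} \<rparr>"

(* The vertex (i, x) is the x-th vertex of the i-th copy of the complete graph (i < 2);
   the second set of arcs is the perfect matching. *)

definition H0 :: "nat \<Rightarrow> (nat \<times> nat) pair_pre_digraph" where
  "H0 a = \<lparr> pverts = {..<2} \<times> {..<a},
     parcs = {((i, x), (i, y)) | i x y. i < 2 \<and> x < a \<and> y < a \<and> x \<noteq> y}
           \<union> {((i, x), (j, x)) | i j x. i < 2 \<and> j < 2 \<and> x < a \<and> i \<noteq> j} \<rparr>"

(* Only meaningful for t \<le> r div 2, where r - 2 * t is not truncated. *)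

definition J :: "nat \<Rightarrow> nat \<Rightarrow> nat \<Rightarrow> ((nat \<times> nat \<times> nat) + (nat \<times> nat)) pair_pre_digraph" where
  "J r a t = join (join_family {..<t} (\<lambda>_. H0 a)) (\<K> (r - 2 * t) a)"


section \<open>Well-formedness\<close>

lemma pair_graph_iff:
  "pair_graph G \<longleftrightarrow> finite (pverts G) \<and> parcs G \<subseteq> pverts G \<times> pverts G \<and>
     irrefl (parcs G) \<and> sym (parcs G)"
  (is "?L \<longleftrightarrow> ?R")
proof
  assume ?L
  then interpret pair_graph G .
  show ?R
    using pair_finite_verts arc_fst_in_verts arc_snd_in_verts pair_no_loops pair_sym_arcs
    by (fastforce simp: irrefl_def symmetric_def)
next
  assume R: ?R
  then have "finite (parcs G)"
    by (meson finite_SigmaI finite_subset)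
  with R show ?L
    by unfold_locales (auto simp: irrefl_def symmetric_def)
qed

lemma pair_graph_join:
  assumes "pair_graph G" "pair_graph H"
  shows "pair_graph (join G H)"
  using assms unfolding pair_graph_iff join_def irrefl_def sym_def by auto

lemma pair_graph_join_family:
  assumes "finite I" "\<And>i. i \<in> I \<Longrightarrow> pair_graph (G i)"
  shows "pair_graph (join_family I G)"
  using assms unfolding pair_graph_iff join_family_def irrefl_def sym_def by auto blast+

lemma pair_graph_complete_multipartite: "pair_graph (\<K> r a)"
  unfolding pair_graph_iff complete_multipartite_def irrefl_def sym_def by auto

lemma pair_graph_H0: "pair_graph (H0 a)"
  unfolding pair_graph_iff H0_def irrefl_def sym_def by auto

lemma pair_graph_J: "pair_graph (J r a t)"
  unfolding J_def
  by (intro pair_graph_join pair_graph_join_family pair_graph_complete_multipartite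
      pair_graph_H0 finite_lessThan)

lemma graph_iso_iff:
  assumes "pair_graph G" "pair_graph H"
  shows "G \<simeq>\<^sub>G H \<longleftrightarrow> (\<exists>f. bij_betw f (pverts G) (pverts H) \<and>
    (\<forall>u\<in>pverts G. \<forall>v\<in>pverts G. (u, v) \<in> parcs G \<longleftrightarrow> (f u, f v) \<in> parcs H))"
  (is "?L \<longleftrightarrow> ?R")
proof
  assume ?L
  then obtain h where h: "pre_digraph.digraph_isomorphism (with_proj G) h"
    and H: "with_proj H = app_iso h (with_proj G)"
    unfolding digraph_iso_def by blast
  let ?f = "iso_verts h"
  have tl: "iso_tail h = fst" and hd: "iso_head h = snd"
    using arg_cong[OF H, of tail] arg_cong[OF H, of head] by simp_all
  have V: "pverts H = ?f ` pverts G" and A: "parcs H = iso_arcs h ` parcs G"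
    using arg_cong[OF H, of verts] arg_cong[OF H, of arcs] by simp_all
  have inj: "inj_on ?f (pverts G)"
    and ar: "\<And>u v. (u, v) \<in> parcs G \<Longrightarrow> iso_arcs h (u, v) = (?f u, ?f v)"
    using h unfolding pre_digraph.digraph_isomorphism_def by (auto simp: tl hd prod_eq_iff)
  have sub: "parcs G \<subseteq> pverts G \<times> pverts G"
    using assms unfolding pair_graph_iff by blast
  have "(u, v) \<in> parcs G \<longleftrightarrow> (?f u, ?f v) \<in> parcs H"
    if uv: "u \<in> pverts G" "v \<in> pverts G" for u v
  proof
    assume "(u, v) \<in> parcs G"
    then show "(?f u, ?f v) \<in> parcs H"
      using ar unfolding A by (metis imageI)
  next
    assume "(?f u, ?f v) \<in> parcs H"
    then obtain u' v' where "(u', v') \<in> parcs G" "(?f u, ?f v) = iso_arcs h (u', v')"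
      unfolding A by auto
    moreover from this have "u' \<in> pverts G" "v' \<in> pverts G" "?f u = ?f u'" "?f v = ?f v'"
      using sub ar by auto
    ultimately show "(u, v) \<in> parcs G"
      using uv inj by (metis inj_onD)
  qed
  then show ?R
    using V inj unfolding bij_betw_def by blast
next
  assume ?R
  then obtain f where f: "inj_on f (pverts G)" "f ` pverts G = pverts H"
    and e: "\<And>u v. u \<in> pverts G \<Longrightarrow> v \<in> pverts G \<Longrightarrow> (u, v) \<in> parcs G \<longleftrightarrow> (f u, f v) \<in> parcs H"
    unfolding bij_betw_def by blast
  define h where "h = \<lparr> iso_verts = f, iso_arcs = map_prod f f,
    iso_head = snd, iso_tail = fst \<rparr>"
  have sub: "parcs G \<subseteq> pverts G \<times> pverts G" "parcs H \<subseteq> pverts H \<times> pverts H"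
    using assms unfolding pair_graph_iff by blast+
  interpret pair_graph G by fact
  have "inj_on (map_prod f f) (parcs G)"
    using map_prod_inj_on[OF f(1) f(1)] sub(1) by (rule inj_on_subset)
  then have "pre_digraph.digraph_isomorphism (with_proj G) h"
    using f(1) wf_digraph_axioms
    unfolding pre_digraph.digraph_isomorphism_def by (auto simp: h_def)
  moreover have "parcs H = map_prod f f ` parcs G"
  proof (intro equalityI subsetI)
    fix p assume p: "p \<in> parcs H"
    then have "p \<in> f ` pverts G \<times> f ` pverts G"
      using sub(2) unfolding f(2) by blast
    then obtain u v where "p = (f u, f v)" "u \<in> pverts G" "v \<in> pverts G"
      by blast
    then show "p \<in> map_prod f f ` parcs G"
      using e p by force
  qed (use e sub(1) in auto)
  then have "with_proj H = app_iso h (with_proj G)"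
    using f(2) by (simp add: app_iso_def h_def with_proj_def)
  ultimately show ?L
    unfolding digraph_iso_def by blast
qed

lemma J_0: "\<K> r a \<simeq>\<^sub>G J r a 0"
  unfolding graph_iso_iff[OF pair_graph_complete_multipartite pair_graph_J]
  by (intro exI[of _ Inr])
     (auto simp: J_def join_def join_family_def complete_multipartite_def bij_betw_def)

end

theory Submission
  imports Defs
begin

text \<open>A set fails to dominate iff it lies in some \<open>N v\<close>, the neighbourhood of a vertex \<open>v\<close> in the
  complement graph. For \<open>\<K>\<^sub>r(a)\<close> there are \<open>r * (a choose i)\<close> such sets of size \<open>0 < i < a\<close> and none of
  size at least \<open>a\<close>. Conversely, suppose that a graph on \<open>r * a\<close> vertices has these counts. Those for
  \<open>i = a\<close> and \<open>i = a - 1\<close> force the sets \<open>N v\<close> to be distinct and of size \<open>a - 1\<close>. A vertex \<open>v\<close> then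
  shares some \<open>N w\<close> with at least \<open>a - 1\<close> other vertices, and the count for \<open>i = 2\<close> says that equality
  holds on average, hence everywhere. So \<open>v\<close> and these vertices form a set \<open>X\<close> of size \<open>a\<close> all of whose
  subsets of size \<open>a - 1\<close> are neighbourhoods, and such sets \<open>X\<close> partition the vertices. Sending \<open>x\<close> to the
  vertex \<open>w\<close> with \<open>N w = X - {x}\<close> is an involution which permutes the parts. In the complement graph, a
  part mapped to itself is a \<open>K\<^sub>a\<close>, and two swapped parts span \<open>K\<^sub>a\<^sub>,\<^sub>a\<close> minus a perfect matching, which is
  the complement of \<open>H0 a\<close>.\<close>

section \<open>Sets that do not dominate\<close>

definition co_nbhd :: "'a pair_pre_digraph \<Rightarrow> 'a \<Rightarrow> 'a set" where
  "co_nbhd G v = pverts G - closed_nbhd G v"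

definition nondominating :: "'a pair_pre_digraph \<Rightarrow> nat \<Rightarrow> 'a set set" where
  "nondominating G i = {S. S \<subseteq> pverts G \<and> card S = i \<and> (\<exists>v\<in>pverts G. S \<subseteq> co_nbhd G v)}"

lemma mem_co_nbhd: "u \<in> co_nbhd G v \<longleftrightarrow> u \<in> pverts G \<and> u \<noteq> v \<and> (v, u) \<notin> parcs G"
  by (auto simp: co_nbhd_def closed_nbhd_def)

text \<open>Failure means that some vertex \<open>v\<close> lies in no closed neighbourhood of a
  member of \<open>S\<close>; since adjacency is symmetric, this says that \<open>S\<close> avoids
  the closed neighbourhood of \<open>v\<close>.\<close>

lemma not_dominating_iff:
  assumes "pair_graph G" "S \<subseteq> pverts G"
  shows "\<not> dominating_set G S \<longleftrightarrow> (\<exists>v\<in>pverts G. S \<subseteq> co_nbhd G v)"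
proof -
  have "parcs G \<subseteq> pverts G \<times> pverts G" "sym (parcs G)"
    using assms(1) unfolding pair_graph_iff by blast+
  then have "closed_nbhd G x \<subseteq> pverts G" if "x \<in> S" for x
    using that assms(2) unfolding closed_nbhd_def by blast
  then have "\<not> dominating_set G S \<longleftrightarrow> (\<exists>v\<in>pverts G. \<forall>x\<in>S. v \<notin> closed_nbhd G x)"
    using assms(2) unfolding dominating_set_def by blast
  also have "\<dots> \<longleftrightarrow> (\<exists>v\<in>pverts G. S \<subseteq> co_nbhd G v)"
    using assms(2) symD[OF \<open>sym (parcs G)\<close>]
    unfolding co_nbhd_def closed_nbhd_def by blast
  finally show ?thesis .
qed

lemma num_dominating_add_nondominating:
  assumes "pair_graph G"
  shows "num_dominating G i + card (nondominating G i) = card (pverts G) choose i"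
proof -
  have fin: "finite (pverts G)"
    using assms unfolding pair_graph_iff by blast
  let ?D = "{S. dominating_set G S \<and> card S = i}"
  have "?D \<union> nondominating G i = {S. S \<subseteq> pverts G \<and> card S = i}"
    "?D \<inter> nondominating G i = {}"
    using not_dominating_iff[OF assms]
    unfolding nondominating_def by (auto simp: dominating_set_def)
  moreover have "finite {S. S \<subseteq> pverts G \<and> card S = i}"
    using fin by simp
  ultimately show ?thesis
    unfolding num_dominating_def n_subsets[OF fin, symmetric]
    by (metis (lifting) card_Un_disjoint finite_Un)
qed

lemma coeff_domination_poly:
  assumes "pair_graph G"
  shows "coeff (domination_poly G) i = (if i = 0 then 0 else int (num_dominating G i))"
proof -
  \<comment> \<open>The sum defining the polynomial stops at the number of vertices, so the larger
    coefficients have to be matched with vanishing counts.\<close>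
  have "num_dominating G i = 0" if "i > card (pverts G)"
    using num_dominating_add_nondominating[OF assms, of i] that by (simp add: binomial_eq_0)
  then show ?thesis
    by (auto simp: domination_poly_def coeff_sum coeff_monom if_distrib[of "\<lambda>f. f _"] sum.delta
        cong: if_cong)
qed

lemma domination_poly_eq_iff:
  assumes "pair_graph G" "pair_graph H"
  shows "domination_poly G = domination_poly H \<longleftrightarrow>
    (\<forall>i>0. num_dominating G i = num_dominating H i)"
  unfolding poly_eq_iff coeff_domination_poly[OF assms(1)] coeff_domination_poly[OF assms(2)]
  by auto

lemma nondominating_card_verts:
  assumes "pair_graph G"
  shows "nondominating G (card (pverts G)) = {}"
proof -
  have "finite (pverts G)"
    using assms unfolding pair_graph_iff by blast
  then have "S = pverts G" if "S \<subseteq> pverts G" "card S = card (pverts G)" for S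
    using that card_subset_eq by blast
  then show ?thesis
    unfolding nondominating_def co_nbhd_def closed_nbhd_def by blast
qed

text \<open>The set of all vertices of \<open>G\<close> dominates, so \<open>H\<close> must also
  have a dominating set of that size. Applied in both directions, this recovers the number of
  vertices from the polynomial.\<close>

lemma card_verts_le_if_num_dominating_eq:
  assumes "pair_graph G" "pair_graph H" "\<forall>i>0. num_dominating G i = num_dominating H i"
  shows "card (pverts G) \<le> card (pverts H)"
proof (cases "card (pverts G) = 0")
  case False
  have "num_dominating G (card (pverts G)) = 1"
    using num_dominating_add_nondominating[OF assms(1), of "card (pverts G)"]
      nondominating_card_verts[OF assms(1)] by simp
  then have "num_dominating H (card (pverts G)) = 1"
    using False assms(3) by simp
  then have "card (pverts H) choose card (pverts G) \<noteq> 0"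
    using num_dominating_add_nondominating[OF assms(2), of "card (pverts G)"] by linarith
  then show ?thesis
    by (simp add: binomial_eq_0_iff)
qed simp

lemma domination_poly_eq_iff_nondominating:
  assumes "pair_graph G" "pair_graph H"
  shows "domination_poly G = domination_poly H \<longleftrightarrow> card (pverts G) = card (pverts H) \<and>
    (\<forall>i>0. card (nondominating G i) = card (nondominating H i))"
proof -
  have verts: "card (pverts G) = card (pverts H)"
    if "\<forall>i>0. num_dominating G i = num_dominating H i"
    using card_verts_le_if_num_dominating_eq[OF assms(1,2)]
      card_verts_le_if_num_dominating_eq[OF assms(2,1)] that by (metis le_antisym)
  have "num_dominating G i = num_dominating H i \<longleftrightarrow>
      card (nondominating G i) = card (nondominating H i)"
    if "card (pverts G) = card (pverts H)" for i
    using num_dominating_add_nondominating[OF assms(1), of i]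
      num_dominating_add_nondominating[OF assms(2), of i] that by auto
  with verts show ?thesis
    unfolding domination_poly_eq_iff[OF assms] by blast
qed

section \<open>Layered graphs\<close>

definition involution_on :: "'i set \<Rightarrow> ('i \<Rightarrow> 'i) \<Rightarrow> bool" where
  "involution_on I \<sigma> \<longleftrightarrow> (\<forall>i\<in>I. \<sigma> i \<in> I \<and> \<sigma> (\<sigma> i) = i)"

text \<open>A fixed point of \<open>\<sigma>\<close> contributes a colour class, a pair of layers swapped by \<open>\<sigma>\<close> a copy of
  \<open>H0 a\<close>.\<close>

definition layered ::
    "'a pair_pre_digraph \<Rightarrow> 'i set \<Rightarrow> ('i \<Rightarrow> 'i) \<Rightarrow> nat \<Rightarrow> ('a \<Rightarrow> 'i \<times> nat) \<Rightarrow> bool" where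
  "layered G I \<sigma> a f \<longleftrightarrow> bij_betw f (pverts G) (I \<times> {..<a}) \<and>
    (\<forall>u\<in>pverts G. \<forall>v\<in>pverts G.
       v \<in> co_nbhd G u \<longleftrightarrow> fst (f v) = \<sigma> (fst (f u)) \<and> snd (f v) \<noteq> snd (f u))"

text \<open>A set of fewer than \<open>a\<close> points in one layer misses some point of it, so the
  puncture is no restriction and the sets are counted layer by layer. With \<open>a\<close> points
  or more there is no room in a punctured layer.\<close>

lemma card_subsets_of_punctured_layers:
  fixes I :: "'i set"
  assumes "finite I" "i > 0"
  shows "card {T. T \<subseteq> I \<times> {..<a} \<and> card T = i \<and> (\<exists>k\<in>I. \<exists>x<a. T \<subseteq> {k} \<times> ({..<a} - {x}))}
    = (if i < a then card I * (a choose i) else 0)" (is "card ?F = _")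
proof (cases "i < a")
  case True
  let ?L = "\<lambda>k::'i. {T. T \<subseteq> {k} \<times> {..<a} \<and> card T = i}"
  have "?F = (\<Union>k\<in>I. ?L k)"
  proof (intro equalityI subsetI)
    fix T assume "T \<in> (\<Union>k\<in>I. ?L k)"
    then obtain k where k: "k \<in> I" "T \<subseteq> {k} \<times> {..<a}" "card T = i"
      by blast
    have "card T < card ({k} \<times> {..<a})"
      using k(3) True by (simp add: card_cartesian_product)
    then have "T \<noteq> {k} \<times> {..<a}" by blast
    then obtain x where "x < a" "(k, x) \<notin> T"
      using k(2) by blast
    then have "x < a" "T \<subseteq> {k} \<times> ({..<a} - {x})"
      using k(2) by auto
    then show "T \<in> ?F"
      using k by blast
  qed blast
  moreover have "card (\<Union>k\<in>I. ?L k) = (\<Sum>k\<in>I. card (?L k))"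
  proof (rule card_UN_disjoint)
    show "\<forall>k\<in>I. \<forall>l\<in>I. k \<noteq> l \<longrightarrow> ?L k \<inter> ?L l = {}"
    proof (intro ballI impI equals0I)
      fix k l :: 'i and T assume "k \<noteq> l" and T: "T \<in> ?L k \<inter> ?L l"
      \<comment> \<open>Only the empty set lies in two layers, and \<open>i > 0\<close> excludes
        it.\<close>
      then have "T = {}" by blast
      then show False
        using T assms(2) by simp
    qed
  qed (use assms(1) in auto)
  moreover have "card (?L k) = a choose i" for k
    using n_subsets[of "{k} \<times> {..<a}" i] by (simp add: card_cartesian_product)
  ultimately show ?thesis
    using True by simp
next
  case False
  have "card T < a" if "T \<subseteq> {k} \<times> ({..<a} - {x})" "x < a" for T :: "('i \<times> nat) set" and k x
  proof -
    have "card T \<le> card ({k::'i} \<times> ({..<a} - {x}))"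
      using that(1) by (intro card_mono) auto
    also have "\<dots> < a"
      using that(2) by (simp add: card_cartesian_product)
    finally show ?thesis .
  qed
  then have "?F = {}"
    using False by blast
  then have "card ?F = 0"
    by (simp only: card.empty)
  then show ?thesis
    using False by simp
qed

lemma layered_co_nbhd_image:
  assumes "layered G I \<sigma> a f" "involution_on I \<sigma>" "v \<in> pverts G"
  shows "f ` co_nbhd G v = {\<sigma> (fst (f v))} \<times> ({..<a} - {snd (f v)})"
proof -
  have bij: "bij_betw f (pverts G) (I \<times> {..<a})"
    and adj: "\<And>u. u \<in> pverts G \<Longrightarrow>
      u \<in> co_nbhd G v \<longleftrightarrow> fst (f u) = \<sigma> (fst (f v)) \<and> snd (f u) \<noteq> snd (f v)"
    using assms(1,3) unfolding layered_def by blast+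
  have fv: "f v \<in> I \<times> {..<a}"
    using bij assms(3) bij_betwE by blast
  show ?thesis
  proof (intro equalityI subsetI)
    fix p assume "p \<in> f ` co_nbhd G v"
    then obtain u where u: "p = f u" "u \<in> co_nbhd G v" by blast
    then have "u \<in> pverts G" by (simp add: mem_co_nbhd)
    then show "p \<in> {\<sigma> (fst (f v))} \<times> ({..<a} - {snd (f v)})"
      using u adj bij_betwE[OF bij] by (force simp: mem_Times_iff)
  next
    fix p assume p: "p \<in> {\<sigma> (fst (f v))} \<times> ({..<a} - {snd (f v)})"
    then have "p \<in> I \<times> {..<a}"
      using fv assms(2) unfolding involution_on_def by auto
    then obtain u where "u \<in> pverts G" "p = f u"
      using bij unfolding bij_betw_def by blast
    then show "p \<in> f ` co_nbhd G v"
      using p adj by auto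
  qed
qed

text \<open>In the coordinates given by \<open>f\<close>, the sets \<open>co_nbhd G v\<close> are
  the layers with one point removed. As \<open>\<sigma>\<close> permutes the layers, all of these
  occur, and the counts do not depend on \<open>\<sigma>\<close>.\<close>

lemma card_nondominating_layered:
  assumes "layered G I \<sigma> a f" "involution_on I \<sigma>" "finite I" "i > 0"
  shows "card (nondominating G i) = (if i < a then card I * (a choose i) else 0)"
proof -
  let ?F = "{T. T \<subseteq> I \<times> {..<a} \<and> card T = i \<and> (\<exists>k\<in>I. \<exists>x<a. T \<subseteq> {k} \<times> ({..<a} - {x}))}"
  have bij: "bij_betw f (pverts G) (I \<times> {..<a})"
    using assms(1) unfolding layered_def by blast
  then have inj: "inj_on f (pverts G)" and img: "f ` pverts G = I \<times> {..<a}"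
    unfolding bij_betw_def by blast+
  have sub: "co_nbhd G v \<subseteq> pverts G" for v
    by (auto simp: mem_co_nbhd)
  have ex: "(\<exists>v\<in>pverts G. f ` S \<subseteq> f ` co_nbhd G v)
      \<longleftrightarrow> (\<exists>k\<in>I. \<exists>x<a. f ` S \<subseteq> {k} \<times> ({..<a} - {x}))" for S
  proof
    assume "\<exists>v\<in>pverts G. f ` S \<subseteq> f ` co_nbhd G v"
    then obtain v where v: "v \<in> pverts G" "f ` S \<subseteq> f ` co_nbhd G v" by blast
    moreover have "f v \<in> I \<times> {..<a}"
      using v img by blast
    ultimately show "\<exists>k\<in>I. \<exists>x<a. f ` S \<subseteq> {k} \<times> ({..<a} - {x})"
      using layered_co_nbhd_image[OF assms(1,2) v(1)] assms(2)
      unfolding involution_on_def mem_Times_iff by (metis lessThan_iff)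
  next
    assume "\<exists>k\<in>I. \<exists>x<a. f ` S \<subseteq> {k} \<times> ({..<a} - {x})"
    then obtain k x where k: "k \<in> I" "x < a" "f ` S \<subseteq> {k} \<times> ({..<a} - {x})" by blast
    \<comment> \<open>The vertex at \<open>(\<sigma> k, x)\<close> has its non-neighbours in layer
      \<open>\<sigma> (\<sigma> k) = k\<close>, which yields the prescribed punctured layer.\<close>
    then have "(\<sigma> k, x) \<in> I \<times> {..<a}"
      using assms(2) unfolding involution_on_def by blast
    then obtain v where "v \<in> pverts G" "f v = (\<sigma> k, x)"
      using img by (metis imageE)
    moreover from this have "f ` co_nbhd G v = {k} \<times> ({..<a} - {x})"
      using layered_co_nbhd_image[OF assms(1,2), of v] k(1) assms(2)
      unfolding involution_on_def by simp
    ultimately show "\<exists>v\<in>pverts G. f ` S \<subseteq> f ` co_nbhd G v"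
      using k(3) by metis
  qed
  have mem: "S \<in> nondominating G i \<longleftrightarrow> f ` S \<in> ?F" if S: "S \<subseteq> pverts G" for S
  proof -
    have "card (f ` S) = card S"
      using S inj by (metis card_image inj_on_subset)
    moreover have "S \<subseteq> co_nbhd G v \<longleftrightarrow> f ` S \<subseteq> f ` co_nbhd G v" for v
    proof (intro iffI subsetI)
      fix t assume "f ` S \<subseteq> f ` co_nbhd G v" "t \<in> S"
      then show "t \<in> co_nbhd G v"
        using inj_on_image_mem_iff[OF inj, of t "co_nbhd G v"] S sub by blast
    qed blast
    ultimately show ?thesis
      using S ex[of S] img unfolding nondominating_def by auto
  qed
  have "bij_betw ((`) f) (nondominating G i) ?F"
  proof (rule bij_betw_subset[OF bij_betw_Pow[OF bij]])
    show "(`) f ` nondominating G i = ?F"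
    proof (intro equalityI subsetI)
      fix T assume T: "T \<in> ?F"
      then obtain S where "S \<subseteq> pverts G" "T = f ` S"
        using img by (metis (lifting) mem_Collect_eq subset_imageE)
      then show "T \<in> (`) f ` nondominating G i"
        using mem T by blast
    next
      fix T assume "T \<in> (`) f ` nondominating G i"
      then obtain S where S: "S \<in> nondominating G i" "T = f ` S" by blast
      then have "S \<subseteq> pverts G"
        by (simp add: nondominating_def)
      then show "T \<in> ?F"
        unfolding S(2) using S(1) by (rule mem[THEN iffD1])
    qed
  qed (auto simp: nondominating_def)
  then show ?thesis
    using card_subsets_of_punctured_layers[OF assms(3,4)] by (simp add: bij_betw_same_card)
qed

lemma card_verts_layered:
  assumes "layered G I \<sigma> a f"
  shows "card (pverts G) = card I * a"
  using assms bij_betw_same_card[of f "pverts G" "I \<times> {..<a}"]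
  unfolding layered_def by (simp add: card_cartesian_product)

lemma domination_poly_eq_if_layered:
  assumes "pair_graph G" "layered G I \<sigma> a f" "involution_on I \<sigma>" "finite I"
    and "pair_graph H" "layered H K \<tau> a g" "involution_on K \<tau>" "finite K"
    and "card I = card K"
  shows "domination_poly G = domination_poly H"
  unfolding domination_poly_eq_iff_nondominating[OF assms(1,5)]
  using card_verts_layered[OF assms(2)] card_verts_layered[OF assms(6)] assms(9)
    card_nondominating_layered[OF assms(2-4)] card_nondominating_layered[OF assms(6-8)]
  by simp

section \<open>Layerings of the complete multipartite graphs and of \<open>J r a t\<close>\<close>

lemma layered_complete_multipartite: "layered (\<K> r a) {..<r} id a id"
  unfolding layered_def by (auto simp: complete_multipartite_def mem_co_nbhd)

text \<open>\<open>Inl (j, i)\<close> stands for clique \<open>i\<close> of the \<open>j\<close>-th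
  copy of \<open>H0 a\<close>, and \<open>Inr k\<close> for the \<open>k\<close>-th colour class.
  \<open>J_swap\<close> exchanges the two cliques of a copy: the non-neighbours of a vertex in one
  clique are the vertices of the other, except its match.\<close>

definition J_layers :: "nat \<Rightarrow> nat \<Rightarrow> (nat \<times> nat + nat) set" where
  "J_layers r t = ({..<t} \<times> {..<2}) <+> {..<r - 2 * t}"

definition J_swap :: "nat \<times> nat + nat \<Rightarrow> nat \<times> nat + nat" where
  "J_swap = map_sum (\<lambda>(j, i). (j, 1 - i)) id"

lemma finite_J_layers: "finite (J_layers r t)"
  by (simp add: J_layers_def)

lemma card_J_layers: "t \<le> r div 2 \<Longrightarrow> card (J_layers r t) = r"
  by (simp add: J_layers_def card_Plus card_cartesian_product)

lemma involution_on_J_swap: "involution_on (J_layers r t) J_swap"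
  by (auto simp: involution_on_def J_layers_def J_swap_def)

lemma layered_J:
  "layered (J r a t) (J_layers r t) J_swap a
    (case_sum (\<lambda>(j, i, x). (Inl (j, i), x)) (\<lambda>(k, x). (Inr k, x)))"
  (is "layered _ _ _ _ ?f")
proof -
  have inj: "inj_on ?f (pverts (J r a t))"
    by (auto simp: inj_on_def split: sum.splits)
  have img: "?f ` pverts (J r a t) = J_layers r t \<times> {..<a}"
  proof (intro equalityI subsetI)
    fix p assume "p \<in> J_layers r t \<times> {..<a}"
    then consider j i x where "p = (Inl (j, i), x)" "j < t" "i < 2" "x < a"
      | k x where "p = (Inr k, x)" "k < r - 2 * t" "x < a"
      unfolding J_layers_def by auto
    then show "p \<in> ?f ` pverts (J r a t)"
    proof cases
      case (1 j i x)
      then show ?thesis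
        by (intro image_eqI[of _ _ "Inl (j, i, x)"])
          (auto simp: J_def join_def join_family_def H0_def)
    next
      case (2 k x)
      then show ?thesis
        by (intro image_eqI[of _ _ "Inr (k, x)"])
          (auto simp: J_def join_def complete_multipartite_def)
    qed
  qed (auto simp: J_def join_def join_family_def H0_def complete_multipartite_def J_layers_def)
  have arcs: "(Inl (j, i, x), Inl (k, l, y)) \<in> parcs (J r a t) \<longleftrightarrow> j < t \<and> k < t \<and> i < 2 \<and> l < 2
        \<and> x < a \<and> y < a \<and> (j \<noteq> k \<or> (i = l \<and> x \<noteq> y) \<or> (i \<noteq> l \<and> x = y))"
    "(Inr (j, x), Inr (k, y)) \<in> parcs (J r a t) \<longleftrightarrow>
      j < r - 2 * t \<and> k < r - 2 * t \<and> x < a \<and> y < a \<and> j \<noteq> k"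
    "(Inl p, Inr q) \<in> parcs (J r a t) \<longleftrightarrow> Inl p \<in> pverts (J r a t) \<and> Inr q \<in> pverts (J r a t)"
    "(Inr q, Inl p) \<in> parcs (J r a t) \<longleftrightarrow> Inl p \<in> pverts (J r a t) \<and> Inr q \<in> pverts (J r a t)"
    for j i x k l y p q
    by (auto simp: J_def join_def join_family_def H0_def complete_multipartite_def)
  have verts: "Inl (j, i, x) \<in> pverts (J r a t) \<longleftrightarrow> j < t \<and> i < 2 \<and> x < a"
    "Inr (j, x) \<in> pverts (J r a t) \<longleftrightarrow> j < r - 2 * t \<and> x < a" for j i x
    by (auto simp: J_def join_def join_family_def H0_def complete_multipartite_def)
  have "v \<in> co_nbhd (J r a t) u \<longleftrightarrow> fst (?f v) = J_swap (fst (?f u)) \<and> snd (?f v) \<noteq> snd (?f u)"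
    if uv: "u \<in> pverts (J r a t)" "v \<in> pverts (J r a t)" for u v
  proof (cases u)
    case u: (Inl p)
    obtain j i x where p: "p = (j, i, x)" by (cases p)
    show ?thesis
    proof (cases v)
      case v: (Inl q)
      obtain k l y where q: "q = (k, l, y)" by (cases q)
      show ?thesis
        using uv less_2_cases[of i] less_2_cases[of l]
        unfolding u v p q mem_co_nbhd arcs verts J_swap_def by auto
    next
      case v: (Inr q)
      show ?thesis
        using uv unfolding u v mem_co_nbhd arcs p by (simp add: J_swap_def split: prod.split)
    qed
  next
    case u: (Inr p)
    obtain j x where p: "p = (j, x)" by (cases p)
    show ?thesis
    proof (cases v)
      case v: (Inl q)
      show ?thesis
        using uv unfolding u v mem_co_nbhd arcs p by (simp add: J_swap_def split: prod.split)
    next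
      case v: (Inr q)
      obtain k y where q: "q = (k, y)" by (cases q)
      show ?thesis
        using uv unfolding u v p q mem_co_nbhd arcs verts J_swap_def by auto
    qed
  qed
  then show ?thesis
    unfolding layered_def bij_betw_def using inj img by blast
qed

section \<open>Isomorphisms of layered graphs\<close>

lemma layered_iso:
  assumes "pair_graph G" "pair_graph H" "G \<simeq>\<^sub>G H" "layered H I \<sigma> a f"
  obtains g where "layered G I \<sigma> a g"
proof -
  obtain h where h: "bij_betw h (pverts G) (pverts H)"
    "\<And>u v. u \<in> pverts G \<Longrightarrow> v \<in> pverts G \<Longrightarrow> (u, v) \<in> parcs G \<longleftrightarrow> (h u, h v) \<in> parcs H"
    using assms(3) unfolding graph_iso_iff[OF assms(1,2)] by blast
  have hV: "h u \<in> pverts H" if "u \<in> pverts G" for u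
    using that h(1) bij_betwE by blast
  have "v \<in> co_nbhd G u \<longleftrightarrow> h v \<in> co_nbhd H (h u)" if "u \<in> pverts G" "v \<in> pverts G" for u v
    using that h hV unfolding mem_co_nbhd bij_betw_def by (metis inj_onD)
  moreover have "bij_betw (f \<circ> h) (pverts G) (I \<times> {..<a})"
    using assms(4) h(1) unfolding layered_def by (blast intro: bij_betw_trans)
  ultimately have "layered G I \<sigma> a (f \<circ> h)"
    using assms(4) hV unfolding layered_def by simp
  then show thesis by (rule that)
qed

text \<open>A layering determines the graph up to the names of its layers. The isomorphism renames
  layers by \<open>b\<close> and keeps the labels.\<close>

lemma iso_if_layered:
  fixes b :: "'i \<Rightarrow> 'k"
  assumes "pair_graph G" "layered G I \<sigma> a f" "involution_on I \<sigma>"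
    and "pair_graph H" "layered H K \<tau> a g"
    and b: "bij_betw b I K" "\<And>i. i \<in> I \<Longrightarrow> b (\<sigma> i) = \<tau> (b i)"
  shows "G \<simeq>\<^sub>G H"
proof -
  let ?m = "map_prod b id :: 'i \<times> nat \<Rightarrow> 'k \<times> nat"
  let ?g = "inv_into (pverts H) g"
  let ?h = "?g \<circ> (?m \<circ> f)"
  have f: "bij_betw f (pverts G) (I \<times> {..<a})" and g: "bij_betw g (pverts H) (K \<times> {..<a})"
    using assms(2,5) unfolding layered_def by blast+
  have mf: "bij_betw (?m \<circ> f) (pverts G) (K \<times> {..<a})"
    using bij_betw_trans[OF f bij_betw_map_prod[OF b(1) bij_betw_id]] .
  have h: "bij_betw ?h (pverts G) (pverts H)"
    using bij_betw_trans[OF mf bij_betw_inv_into[OF g]] .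
  have gh: "g (?h u) = (b (fst (f u)), snd (f u))" if "u \<in> pverts G" for u
  proof -
    have "(?m \<circ> f) u \<in> g ` pverts H"
      using that mf g unfolding bij_betw_def by blast
    then show ?thesis
      by (simp add: f_inv_into_f prod_eq_iff)
  qed
  have hV: "?h u \<in> pverts H" if "u \<in> pverts G" for u
    using that h bij_betwE by blast
  have fI: "fst (f u) \<in> I" if "u \<in> pverts G" for u
    using that f bij_betwE by (metis mem_Times_iff)
  have co: "v \<in> co_nbhd G u \<longleftrightarrow> ?h v \<in> co_nbhd H (?h u)"
    if uv: "u \<in> pverts G" "v \<in> pverts G" for u v
  proof -
    have "\<sigma> (fst (f u)) \<in> I"
      using fI[OF uv(1)] assms(3) unfolding involution_on_def by blast
    then have "fst (f v) = \<sigma> (fst (f u)) \<longleftrightarrow> b (fst (f v)) = \<tau> (b (fst (f u)))"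
      using fI uv b unfolding bij_betw_def inj_on_def by metis
    then have "v \<in> co_nbhd G u \<longleftrightarrow>
        fst (g (?h v)) = \<tau> (fst (g (?h u))) \<and> snd (g (?h v)) \<noteq> snd (g (?h u))"
      using assms(2) uv unfolding layered_def gh[OF uv(1)] gh[OF uv(2)] by simp
    then show ?thesis
      using assms(5) hV uv unfolding layered_def by blast
  qed
  \<comment> \<open>\<open>co_nbhd\<close> determines adjacency only between distinct vertices; the
    diagonal is settled by the absence of loops.\<close>
  have irr: "(u, u) \<notin> parcs G" "(w, w) \<notin> parcs H" for u w
    using assms(1,4) unfolding pair_graph_iff irrefl_def by blast+
  have "(u, v) \<in> parcs G \<longleftrightarrow> (?h u, ?h v) \<in> parcs H"
    if uv: "u \<in> pverts G" "v \<in> pverts G" for u v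
  proof -
    have "u = v \<longleftrightarrow> ?h u = ?h v"
      using uv h unfolding bij_betw_def inj_on_def by blast
    then show ?thesis
      using co[OF uv] hV uv irr unfolding mem_co_nbhd by metis
  qed
  then show ?thesis
    unfolding graph_iso_iff[OF assms(1,4)] using h by blast
qed

text \<open>An involution of a finite set is determined up to conjugacy by its number of 2-cycles,
  which is the \<open>t\<close> obtained here.\<close>

lemma involution_conjugate_J_swap:
  assumes "finite I" "involution_on I \<sigma>"
  obtains t b where "t \<le> card I div 2" "bij_betw b I (J_layers (card I) t)"
    "\<And>i. i \<in> I \<Longrightarrow> b (\<sigma> i) = J_swap (b i)"
proof -
  have s: "\<sigma> i \<in> I" "\<sigma> (\<sigma> i) = i" if "i \<in> I" for i
    using that assms(2) unfolding involution_on_def by blast+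
  \<comment> \<open>A representative of the orbit of \<open>i\<close>. Choosing it from the
    unordered set makes it the same for \<open>i\<close> and \<open>\<sigma> i\<close>.\<close>
  define \<rho> where "\<rho> i = (SOME j. j \<in> {i, \<sigma> i})" for i
  have \<rho>: "\<rho> i = i \<or> \<rho> i = \<sigma> i" for i
    unfolding \<rho>_def by (rule someI2[of _ i]) auto
  have \<rho>s: "\<rho> (\<sigma> i) = \<rho> i" if "i \<in> I" for i
    unfolding \<rho>_def s(2)[OF that] by (simp add: insert_commute)
  define A where "A = {i \<in> I. \<sigma> i \<noteq> i \<and> \<rho> i = i}"
  define F where "F = {i \<in> I. \<sigma> i = i}"
  have fin: "finite A" "finite F" "finite (\<sigma> ` A)"
    using assms(1) unfolding A_def F_def by auto
  have inj: "inj_on \<sigma> A"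
    by (rule inj_on_inverseI[of _ \<sigma>]) (simp add: A_def s)
  have sA: "\<sigma> ` A = {i \<in> I. \<sigma> i \<noteq> i \<and> \<rho> i \<noteq> i}"
  proof (intro equalityI subsetI)
    fix i assume "i \<in> {i \<in> I. \<sigma> i \<noteq> i \<and> \<rho> i \<noteq> i}"
    then have i: "i \<in> I" "\<sigma> i \<noteq> i" "\<rho> i \<noteq> i" by blast+
    then have "\<sigma> i \<in> A" "i = \<sigma> (\<sigma> i)"
      using s[OF i(1)] \<rho>[of i] \<rho>s[OF i(1)] unfolding A_def by simp_all
    then show "i \<in> \<sigma> ` A" by blast
  next
    fix i assume "i \<in> \<sigma> ` A"
    then obtain j where j: "j \<in> I" "\<sigma> j \<noteq> j" "\<rho> j = j" "i = \<sigma> j"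
      unfolding A_def by blast
    show "i \<in> {i \<in> I. \<sigma> i \<noteq> i \<and> \<rho> i \<noteq> i}"
      using s[OF j(1)] \<rho>s[OF j(1)] j by simp
  qed
  have "I = (A \<union> \<sigma> ` A) \<union> F" "A \<inter> \<sigma> ` A = {}" "(A \<union> \<sigma> ` A) \<inter> F = {}"
    unfolding sA unfolding A_def F_def by blast+
  then have cI: "card I = 2 * card A + card F"
    using fin card_image[OF inj] by (metis card_Un_disjoint finite_Un mult_2)
  obtain e where e: "bij_betw e A {..<card A}"
    using fin(1) ex_bij_betw_finite_nat[of A] by (auto simp: atLeast0LessThan)
  obtain e' where e': "bij_betw e' F {..<card I - 2 * card A}"
    using fin(2) ex_bij_betw_finite_nat[of F] cI by (auto simp: atLeast0LessThan)
  \<comment> \<open>Fixed points become colour classes; in a 2-cycle the representative becomes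
    clique 0 and the other element clique 1 of the same copy.\<close>
  define b where "b i = (if \<sigma> i = i then Inr (e' i) else
    if \<rho> i = i then Inl (e i, 0 :: nat) else Inl (e (\<sigma> i), 1))" for i
  have inA: "\<sigma> i \<in> A" if "i \<in> I" "\<sigma> i \<noteq> i" "\<rho> i \<noteq> i" for i
    using that s[OF that(1)] \<rho>[of i] \<rho>s[OF that(1)] unfolding A_def by simp
  have b_cases: "i \<in> F \<and> b i = Inr (e' i) \<or> i \<in> A \<and> b i = Inl (e i, 0) \<or>
      \<sigma> i \<in> A \<and> b i = Inl (e (\<sigma> i), 1)" if "i \<in> I" for i
    using that inA[of i] unfolding b_def F_def A_def by simp
  have injb: "inj_on b I"
  proof (rule inj_onI)
    fix i j assume ij: "i \<in> I" "j \<in> I" "b i = b j"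
    from b_cases[OF ij(1)] show "i = j"
    proof (elim disjE conjE)
      assume i: "i \<in> F" "b i = Inr (e' i)"
      then have "Inr (e' i) = b j"
        using ij(3) by simp
      then have "j \<in> F" "e' i = e' j"
        using b_cases[OF ij(2)] by auto
      then show ?thesis
        using i(1) e' unfolding bij_betw_def by (metis inj_onD)
    next
      assume i: "i \<in> A" "b i = Inl (e i, 0)"
      then have "Inl (e i, 0) = b j"
        using ij(3) by simp
      then have "j \<in> A" "e i = e j"
        using b_cases[OF ij(2)] by auto
      then show ?thesis
        using i(1) e unfolding bij_betw_def by (metis inj_onD)
    next
      assume i: "\<sigma> i \<in> A" "b i = Inl (e (\<sigma> i), 1)"
      then have "Inl (e (\<sigma> i), 1) = b j"
        using ij(3) by simp
      then have "\<sigma> j \<in> A" "e (\<sigma> i) = e (\<sigma> j)"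
        using b_cases[OF ij(2)] by auto
      then have "\<sigma> i = \<sigma> j"
        using i(1) e unfolding bij_betw_def by (metis inj_onD)
      then show ?thesis
        using s(2)[OF ij(1)] s(2)[OF ij(2)] by metis
    qed
  qed
  have "b ` I \<subseteq> J_layers (card I) (card A)"
  proof (intro image_subsetI)
    fix i assume i: "i \<in> I"
    have "e k < card A" if "k \<in> A" for k
      using that e bij_betwE by blast
    moreover have "e' i < card I - 2 * card A" if "i \<in> F"
      using that e' bij_betwE by blast
    ultimately show "b i \<in> J_layers (card I) (card A)"
      using b_cases[OF i] unfolding J_layers_def by force
  qed
  moreover have le: "card A \<le> card I div 2"
    using cI by simp
  ultimately have "b ` I = J_layers (card I) (card A)"
    using injb by (intro card_subset_eq) (simp_all add: finite_J_layers card_J_layers card_image)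
  then have "bij_betw b I (J_layers (card I) (card A))"
    using injb unfolding bij_betw_def by blast
  moreover have "b (\<sigma> i) = J_swap (b i)" if "i \<in> I" for i
    using s[OF that] \<rho>[of i] \<rho>s[OF that] unfolding b_def J_swap_def by auto
  ultimately show thesis
    using that le by blast
qed

section \<open>Reconstruction from the counts\<close>

lemma sum_card_incident:
  assumes "finite V" "finite E" "\<And>S. S \<in> E \<Longrightarrow> S \<subseteq> V"
  shows "(\<Sum>v\<in>V. card {S \<in> E. v \<in> S}) = (\<Sum>S\<in>E. card S)"
proof -
  have "(\<Sum>v\<in>V. card {S \<in> E. v \<in> S}) = (\<Sum>S\<in>E. card {v \<in> V. v \<in> S})"
    using assms(1,2) by (rule sum_multicount_gen) simp
  also have "{v \<in> V. v \<in> S} = S" if "S \<in> E" for S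
    using assms(3)[OF that] by blast
  then have "(\<Sum>S\<in>E. card {v \<in> V. v \<in> S}) = (\<Sum>S\<in>E. card S)"
    by simp
  finally show ?thesis .
qed

text \<open>Supplies a member of a class that avoids two given vertices; \<open>a \<ge> 4\<close>
  makes even \<open>linked v\<close>, of size \<open>a - 1\<close>, large enough.\<close>

lemma ex_third:
  assumes "finite A" "card A \<ge> 3"
  shows "\<exists>z\<in>A. z \<noteq> x \<and> z \<noteq> y"
proof (rule ccontr)
  assume "\<not> ?thesis"
  then have "A \<subseteq> {x, y}" by blast
  then have "card A \<le> card {x, y}"
    by (intro card_mono) auto
  also have "\<dots> \<le> 2"
    by (simp add: card_insert_if)
  finally show False
    using assms(2) by simp
qed

text \<open>\<open>N\<close> is the neighbourhood map of the complement graph.\<close>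

locale neighbourhood_system =
  fixes V :: "'v set" and N :: "'v \<Rightarrow> 'v set" and a r :: nat
  assumes fin: "finite V"
    and N_sub: "N v \<subseteq> V"
    and N_irrefl: "v \<notin> N v"
    and N_sym: "u \<in> V \<Longrightarrow> v \<in> V \<Longrightarrow> u \<in> N v \<Longrightarrow> v \<in> N u"
    and a_ge: "a \<ge> 4"
    and card_V: "card V = r * a"
    and count: "i > 0 \<Longrightarrow> card {S. S \<subseteq> V \<and> card S = i \<and> (\<exists>v\<in>V. S \<subseteq> N v)}
      = (if i < a then r * (a choose i) else 0)"
begin

text \<open>The vertices sharing a neighbour with \<open>v\<close> in the complement graph. The
  pairs \<open>{u, v}\<close> with \<open>u \<in> linked v\<close> are those that
  \<open>count\<close> counts at \<open>i = 2\<close>.\<close>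

definition linked :: "'v \<Rightarrow> 'v set" where
  "linked v = {u \<in> V. u \<noteq> v \<and> (\<exists>w\<in>V. u \<in> N w \<and> v \<in> N w)}"

definition cls :: "'v \<Rightarrow> 'v set" where
  "cls v = insert v (linked v)"

section \<open>Sizes of neighbourhoods and of linked sets\<close>

lemma finite_N: "finite (N v)"
  using N_sub fin finite_subset by blast

lemma finite_linked: "finite (linked v)"
  using fin unfolding linked_def by simp

text \<open>Otherwise \<open>N v\<close> would contain a set of size \<open>a\<close>, contrary to
  the zero count at \<open>i = a\<close>.\<close>

lemma card_N_less: "v \<in> V \<Longrightarrow> card (N v) < a"
proof (rule ccontr)
  assume v: "v \<in> V" "\<not> card (N v) < a"
  then obtain S where S: "S \<subseteq> N v" "card S = a"
    by (meson not_less obtain_subset_with_card_n)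
  have "card {S. S \<subseteq> V \<and> card S = a \<and> (\<exists>v\<in>V. S \<subseteq> N v)} = 0"
    using count[of a] a_ge by simp
  moreover have "finite {S. S \<subseteq> V \<and> card S = a \<and> (\<exists>v\<in>V. S \<subseteq> N v)}"
    using fin by simp
  ultimately show False
    using S v(1) N_sub[of v] by auto
qed

text \<open>Only neighbourhoods of size \<open>a - 1\<close> cover a set of that size, and each covers just one; there
  are as many covered sets as vertices.\<close>

lemma inj_on_N: "inj_on N V"
  and card_N: "v \<in> V \<Longrightarrow> card (N v) = a - 1"
proof -
  let ?E = "{S. S \<subseteq> V \<and> card S = a - 1 \<and> (\<exists>v\<in>V. S \<subseteq> N v)}"
  have sub: "?E \<subseteq> N ` {v \<in> V. card (N v) = a - 1}"
  proof
    fix S assume "S \<in> ?E"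
    then obtain v where v: "v \<in> V" "S \<subseteq> N v" "card S = a - 1" by blast
    then have "card (N v) = a - 1"
      using card_N_less[OF v(1)] card_mono[OF finite_N v(2)] by linarith
    moreover have "S = N v"
      using v calculation card_subset_eq[OF finite_N] by simp
    ultimately show "S \<in> N ` {v \<in> V. card (N v) = a - 1}"
      using v(1) by blast
  qed
  have "a choose (a - 1) = a"
    using binomial_symmetric[of 1 a] a_ge by simp
  then have "card ?E = card V"
    using count[of "a - 1"] a_ge card_V by simp
  moreover have "card ?E \<le> card (N ` {v \<in> V. card (N v) = a - 1})"
    using sub fin by (intro card_mono) auto
  moreover have "\<dots> \<le> card {v \<in> V. card (N v) = a - 1}"
    using fin by (intro card_image_le) auto
  moreover have "\<dots> \<le> card V"
    using fin by (intro card_mono) auto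
  ultimately have eq: "card {v \<in> V. card (N v) = a - 1} = card V"
    and inj: "card (N ` {v \<in> V. card (N v) = a - 1}) = card {v \<in> V. card (N v) = a - 1}"
    by linarith+
  have all: "{v \<in> V. card (N v) = a - 1} = V"
    using eq fin by (intro card_subset_eq) auto
  show "card (N v) = a - 1" if "v \<in> V"
    using that all by blast
  show "inj_on N V"
    using inj fin unfolding all by (intro eq_card_imp_inj_on) auto
qed

lemma linked_sym: "u \<in> V \<Longrightarrow> v \<in> V \<Longrightarrow> u \<in> linked v \<longleftrightarrow> v \<in> linked u"
  unfolding linked_def by blast

text \<open>The vertex \<open>w\<close> is itself a common neighbour of \<open>v\<close> and of
  every other member of \<open>N w\<close>.\<close>

lemma N_subset_cls: "v \<in> V \<Longrightarrow> w \<in> N v \<Longrightarrow> N w \<subseteq> cls v \<and> v \<in> N w"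
  using N_sub N_sym unfolding cls_def linked_def by blast

text \<open>If \<open>cls v\<close> had at most \<open>a - 1\<close> elements, each
  \<open>N w\<close> with \<open>w \<in> N v\<close> would fill it, whereas \<open>N\<close> is
  injective and \<open>N v\<close> has more than one element.\<close>

lemma card_linked_ge:
  assumes "v \<in> V"
  shows "a - 1 \<le> card (linked v)"
proof (rule ccontr)
  assume "\<not> a - 1 \<le> card (linked v)"
  then have le: "card (cls v) \<le> a - 1"
    using card_insert_le_m1[of "a - 1" "linked v" v] a_ge unfolding cls_def by simp
  have "N w = cls v" if w: "w \<in> N v" for w
  proof (rule card_subset_eq)
    show "card (N w) = card (cls v)"
      using card_N[of w] N_sub[of v] w le N_subset_cls[OF assms w]
        card_mono[of "cls v" "N w"] finite_linked by (force simp: cls_def)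
  qed (use N_subset_cls[OF assms w] finite_linked in \<open>auto simp: cls_def\<close>)
  moreover have "inj_on N (N v)"
    using inj_on_N N_sub inj_on_subset by blast
  ultimately have "card (N v) \<le> card {cls v}"
    by (intro card_inj_on_le[of N]) auto
  then show False
    using card_N[OF assms] a_ge by simp
qed

text \<open>The number of covered pairs makes \<open>a - 1\<close> the average of \<open>card (linked v)\<close>.\<close>

lemma card_linked:
  assumes "v \<in> V"
  shows "card (linked v) = a - 1"
proof -
  let ?E = "{S. S \<subseteq> V \<and> card S = 2 \<and> (\<exists>v\<in>V. S \<subseteq> N v)}"
  have deg: "card {S \<in> ?E. u \<in> S} = card (linked u)" if u: "u \<in> V" for u
  proof -
    have "bij_betw (\<lambda>w. {u, w}) (linked u) {S \<in> ?E. u \<in> S}"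
    proof (rule bij_betw_imageI)
      show "inj_on (\<lambda>w. {u, w}) (linked u)"
        by (auto simp: inj_on_def linked_def doubleton_eq_iff)
      show "(\<lambda>w. {u, w}) ` linked u = {S \<in> ?E. u \<in> S}"
      proof (intro equalityI subsetI)
        fix S assume "S \<in> {S \<in> ?E. u \<in> S}"
        then obtain x where x: "S \<subseteq> V" "card S = 2" "x \<in> V" "S \<subseteq> N x" "u \<in> S" by blast
        then obtain w where "S = {u, w}" "w \<noteq> u"
          unfolding card_2_iff by blast
        moreover from this have "w \<in> linked u"
          using x unfolding linked_def by blast
        ultimately show "S \<in> (\<lambda>w. {u, w}) ` linked u" by blast
      qed (use u in \<open>auto simp: linked_def\<close>)
    qed
    then show ?thesis
      by (simp add: bij_betw_same_card)
  qed
  \<comment> \<open>Double counting of the incidences between vertices and covered pairs.\<close>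
  have "(\<Sum>u\<in>V. card (linked u)) = (\<Sum>u\<in>V. card {S \<in> ?E. u \<in> S})"
    using deg by simp
  also have "\<dots> = (\<Sum>S\<in>?E. card S)"
    using fin by (intro sum_card_incident) auto
  also have "\<dots> = 2 * card ?E"
    by simp
  also have "\<dots> = r * (2 * (a choose 2))"
    using count[of 2] a_ge by simp
  also have "2 * (a choose 2) = a * (a - 1)"
    by (cases a) (simp_all add: choose_two)
  also have "r * (a * (a - 1)) = (\<Sum>u\<in>V. a - 1)"
    using card_V by simp
  finally have sum_eq: "(\<Sum>u\<in>V. card (linked u)) = (\<Sum>u\<in>V. a - 1)" .
  show ?thesis
  proof (rule ccontr)
    assume "card (linked v) \<noteq> a - 1"
    then have "a - 1 < card (linked v)"
      using card_linked_ge[OF assms] by simp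
    then have "(\<Sum>u\<in>V. a - 1) < (\<Sum>u\<in>V. card (linked u))"
      using card_linked_ge assms by (intro sum_strict_mono_ex1[OF fin]) blast+
    then show False
      using sum_eq by simp
  qed
qed

section \<open>The classes partition the vertices\<close>

lemma not_mem_linked: "v \<notin> linked v"
  by (simp add: linked_def)

lemma cls_subset: "v \<in> V \<Longrightarrow> cls v \<subseteq> V"
  by (auto simp: cls_def linked_def)

lemma finite_cls: "finite (cls v)"
  by (simp add: cls_def finite_linked)

lemma card_cls: "v \<in> V \<Longrightarrow> card (cls v) = a"
  using card_linked[of v] a_ge not_mem_linked[of v] finite_linked[of v] by (simp add: cls_def)

text \<open>Each \<open>N w\<close> with \<open>w \<in> N v\<close> is \<open>cls v\<close> without
  one element of \<open>linked v\<close>. There are \<open>a - 1\<close> such neighbourhoods, all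
  distinct, and only \<open>a - 1\<close> elements to leave out, so each one is left out by some
  \<open>w\<close>.\<close>

lemma ex_N_eq_cls_minus_linked:
  assumes v: "v \<in> V" and x: "x \<in> linked v"
  shows "\<exists>w\<in>N v. N w = cls v - {x}"
proof -
  let ?R = "(\<lambda>x. cls v - {x}) ` linked v"
  have "N w \<in> ?R" if w: "w \<in> N v" for w
  proof -
    have "w \<in> V"
      using w N_sub by blast
    then have "N w \<noteq> cls v"
      using card_N[of w] card_cls[OF v] a_ge by auto
    then obtain x where x: "x \<in> cls v" "x \<notin> N w"
      using N_subset_cls[OF v w] by blast
    then have "N w = cls v - {x}"
      using N_subset_cls[OF v w] card_N[OF \<open>w \<in> V\<close>] card_cls[OF v] finite_cls
      by (intro card_subset_eq) auto
    moreover have "x \<in> linked v"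
      using x N_subset_cls[OF v w] unfolding cls_def by blast
    ultimately show ?thesis by blast
  qed
  then have "N ` N v \<subseteq> ?R" by blast
  moreover have "card (N ` N v) = a - 1"
    using card_N[OF v] inj_on_N N_sub by (metis card_image inj_on_subset)
  moreover have "card ?R \<le> a - 1"
    using card_image_le[OF finite_linked, of "\<lambda>x. cls v - {x}" v] card_linked[OF v] by simp
  ultimately have "N ` N v = ?R"
    using finite_linked by (intro card_seteq) auto
  then show ?thesis
    using x by (metis (no_types, lifting) image_iff)
qed

text \<open>For \<open>x\<close> in \<open>cls v\<close>, some neighbourhood is \<open>cls v\<close>
  without a third vertex \<open>z\<close>. It contains both \<open>u\<close> and \<open>x\<close>,
  so \<open>x\<close> is in \<open>cls u\<close>; equal sizes turn the inclusion into
  equality.\<close>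

lemma cls_eq:
  assumes v: "v \<in> V" and u: "u \<in> cls v"
  shows "cls u = cls v"
proof (rule sym, rule card_subset_eq)
  have uV: "u \<in> V"
    using assms cls_subset by blast
  show "card (cls v) = card (cls u)"
    using card_cls v uV by simp
  show "cls v \<subseteq> cls u"
  proof
    fix x assume x: "x \<in> cls v"
    obtain z where z: "z \<in> linked v" "z \<noteq> u" "z \<noteq> x"
      using ex_third[OF finite_linked, of v u x] card_linked[OF v] a_ge by fastforce
    then obtain w where "w \<in> N v" "N w = cls v - {z}"
      using ex_N_eq_cls_minus_linked[OF v] by blast
    then have "u \<in> N w" "x \<in> N w" "w \<in> V"
      using u x z N_sub by auto
    then show "x \<in> cls u"
      using N_sub unfolding cls_def linked_def by blast
  qed
qed (rule finite_cls)

lemma cls_minus_self: "cls v - {v} = linked v"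
  using not_mem_linked by (auto simp: cls_def)

text \<open>\<open>ex_N_eq_cls_minus_linked\<close> cannot remove the base vertex of a class, so the
  class of \<open>x\<close> is viewed from another member \<open>v\<close>.\<close>

lemma ex_N_eq_linked:
  assumes x: "x \<in> V"
  shows "\<exists>w\<in>V. N w = linked x"
proof -
  obtain v where v: "v \<in> linked x"
    using card_linked[OF x] a_ge by fastforce
  then have "v \<in> V" "x \<in> linked v"
    using x linked_sym unfolding linked_def by blast+
  then obtain w where "w \<in> N v" "N w = cls v - {x}"
    using ex_N_eq_cls_minus_linked by blast
  moreover have "v \<in> cls x"
    using v by (simp add: cls_def)
  then have "cls v = cls x"
    by (rule cls_eq[OF x])
  ultimately have "w \<in> V" "N w = linked x"
    using N_sub cls_minus_self by auto
  then show ?thesis by blast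
qed

text \<open>In a copy of \<open>H0 a\<close> this is the vertex matched with \<open>x\<close>, and
  in a colour class it is \<open>x\<close> itself. Injectivity of \<open>N\<close> leaves only one
  choice.\<close>

definition partner :: "'v \<Rightarrow> 'v" where
  "partner x = (SOME w. w \<in> V \<and> N w = linked x)"

lemma partner:
  assumes "x \<in> V"
  shows "partner x \<in> V" "N (partner x) = linked x"
  using someI_ex[OF ex_N_eq_linked[OF assms, unfolded Bex_def]] unfolding partner_def by blast+

text \<open>\<open>linked x\<close> is nonempty and hence determines the class of \<open>x\<close>,
  in which \<open>x\<close> is the only vertex missing from \<open>linked x\<close>.\<close>

lemma inj_on_partner: "inj_on partner V"
proof (rule inj_onI)
  fix x y assume xy: "x \<in> V" "y \<in> V" "partner x = partner y"
  then have eq: "linked x = linked y"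
    using partner(2) by metis
  obtain z where "z \<in> linked x"
    using card_linked[OF xy(1)] a_ge by fastforce
  then have "cls x = cls y"
    using cls_eq xy eq unfolding cls_def by (metis insertI2)
  then show "x = y"
    using eq not_mem_linked[of x] not_mem_linked[of y] unfolding cls_def by blast
qed

text \<open>For \<open>y\<close> in \<open>cls x\<close>, a third member \<open>z\<close> of the
  class lies in both \<open>N (partner x)\<close> and \<open>N (partner y)\<close>, so it is a
  common neighbour of the two partners.\<close>

lemma cls_partner:
  assumes x: "x \<in> V"
  shows "cls (partner x) = partner ` cls x"
proof (rule sym, rule card_subset_eq)
  have inj: "inj_on partner (cls x)"
    using inj_on_partner cls_subset[OF x] inj_on_subset by blast
  show "card (partner ` cls x) = card (cls (partner x))"
    using card_image[OF inj] card_cls x partner(1) by simp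
  show "partner ` cls x \<subseteq> cls (partner x)"
  proof (rule image_subsetI)
    fix y assume y: "y \<in> cls x"
    then have yV: "y \<in> V"
      using cls_subset[OF x] by blast
    obtain z where z: "z \<in> cls x" "z \<noteq> x" "z \<noteq> y"
      using ex_third[OF finite_cls, of x x y] card_cls[OF x] a_ge by auto
    then have zV: "z \<in> V"
      using cls_subset[OF x] by blast
    have "z \<in> N (partner x)" "z \<in> N (partner y)"
      using z partner(2) x yV cls_eq[OF x y] cls_minus_self by blast+
    then have "partner x \<in> N z" "partner y \<in> N z"
      using N_sym zV partner(1) x yV by blast+
    then show "partner y \<in> cls (partner x)"
      using zV N_sub unfolding cls_def linked_def by blast
  qed
qed (rule finite_cls)

text \<open>If \<open>x \<in> linked y\<close>, then
  \<open>y \<in> linked x = N (partner x)\<close>, so \<open>partner x \<in> N y\<close>. By size,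
  \<open>partner\<close> maps \<open>linked y\<close> onto \<open>N y\<close>; the image is also
  \<open>linked (partner y)\<close>, the neighbourhood of \<open>partner (partner y)\<close>, and
  \<open>N\<close> is injective.\<close>

lemma partner_partner:
  assumes y: "y \<in> V"
  shows "partner (partner y) = y"
proof -
  have inj: "inj_on partner (cls y)"
    using inj_on_partner cls_subset[OF y] inj_on_subset by blast
  have "partner ` linked y = N y"
  proof (rule card_subset_eq)
    show "card (partner ` linked y) = card (N y)"
      using card_linked[OF y] card_N[OF y] inj
      by (metis card_image cls_def inj_on_subset subset_insertI)
    show "partner ` linked y \<subseteq> N y"
    proof (rule image_subsetI)
      fix x assume "x \<in> linked y"
      then have "x \<in> V" "y \<in> linked x"
        using y linked_sym unfolding linked_def by blast+
      then show "partner x \<in> N y"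
        using partner N_sym y by metis
    qed
  qed (rule finite_N)
  moreover have "partner ` linked y = cls (partner y) - {partner y}"
    using cls_partner[OF y] inj not_mem_linked[of y] unfolding cls_def
    by (auto simp: inj_on_def)
  ultimately have "N y = N (partner (partner y))"
    using cls_minus_self partner[OF y] partner(2) by simp
  then show ?thesis
    using inj_on_N y partner(1) by (metis inj_onD)
qed

text \<open>Otherwise \<open>partner x\<close> would lie in \<open>linked x\<close>, which is its
  own neighbourhood.\<close>

lemma partner_eq_self:
  assumes "x \<in> V" "partner x \<in> cls x"
  shows "partner x = x"
  using assms partner[of x] N_irrefl[of "partner x"] unfolding cls_def by auto

lemma mem_N_iff:
  assumes "u \<in> V" "v \<in> V"
  shows "v \<in> N u \<longleftrightarrow> cls v = cls (partner u) \<and> v \<noteq> partner u"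
proof -
  have "N u = cls (partner u) - {partner u}"
    using partner_partner[OF assms(1)] partner(1)[OF assms(1)] partner(2) cls_minus_self by metis
  moreover have "v \<in> cls (partner u) \<longleftrightarrow> cls v = cls (partner u)"
    using cls_eq partner(1)[OF assms(1)] by (metis cls_def insertI1)
  ultimately show ?thesis by blast
qed

section \<open>Labels within the classes and the resulting layering\<close>

text \<open>The labels on a class \<open>Z\<close> and on its image under \<open>partner\<close> must agree along \<open>partner\<close>, so they
  are chosen on only one of the two.\<close>

lemma ex_labelling:
  "\<exists>l. \<forall>v\<in>V. bij_betw l (cls v) {..<a} \<and> l (partner v) = l v"
proof -
  have "\<forall>Z\<in>cls ` V. \<exists>h. bij_betw h Z {..<a}"
    using card_cls finite_cls by (auto intro!: finite_same_card_bij)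
  then obtain h where h: "\<And>Z. Z \<in> cls ` V \<Longrightarrow> bij_betw (h Z) Z {..<a}"
    by metis
  \<comment> \<open>One of the two classes of a swapped pair, chosen from the unordered pair so that
    \<open>v\<close> and \<open>partner v\<close> get the same one.\<close>
  define \<rho> where "\<rho> v = (SOME Y. Y \<in> {cls v, cls (partner v)})" for v
  have \<rho>: "\<rho> v = cls v \<or> \<rho> v = cls (partner v)" for v
    unfolding \<rho>_def by (rule someI2[of _ "cls v"]) auto
  have \<rho>_partner: "\<rho> (partner v) = \<rho> v" if "v \<in> V" for v
    unfolding \<rho>_def partner_partner[OF that] by (simp add: insert_commute)
  have \<rho>_cls: "\<rho> u = \<rho> v" if "v \<in> V" "u \<in> cls v" for u v
  proof -
    have "u \<in> V" "cls u = cls v"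
      using that cls_eq cls_subset by blast+
    then show ?thesis
      unfolding \<rho>_def using cls_partner that(1) by simp
  qed
  \<comment> \<open>A vertex outside the chosen class borrows the label of its partner, which lies
    inside.\<close>
  define l where "l v = h (\<rho> v) (if v \<in> \<rho> v then v else partner v)" for v
  have "bij_betw l (cls v) {..<a}" if v: "v \<in> V" for v
  proof (cases "\<rho> v = cls v")
    case True
    have "bij_betw (h (cls v)) (cls v) {..<a}"
      using h v by blast
    then show ?thesis
      by (rule bij_betw_cong[THEN iffD1, rotated]) (use True \<rho>_cls[OF v] in \<open>simp add: l_def\<close>)
  next
    case False
    then have r: "\<rho> v = cls (partner v)"
      using \<rho> by blast
    have "bij_betw partner (cls v) (\<rho> v)"
      unfolding r cls_partner[OF v] using inj_on_partner cls_subset[OF v]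
      by (intro inj_on_imp_bij_betw) (rule inj_on_subset)
    moreover have "bij_betw (h (\<rho> v)) (\<rho> v) {..<a}"
      using h v partner(1) r by simp
    ultimately have "bij_betw (h (\<rho> v) \<circ> partner) (cls v) {..<a}"
      by (rule bij_betw_trans)
    moreover have "(h (\<rho> v) \<circ> partner) u = l u" if u: "u \<in> cls v" for u
    proof -
      have "u \<notin> \<rho> v"
        using False r cls_eq v partner(1) u by metis
      then show ?thesis
        using \<rho>_cls[OF v u] by (simp add: l_def)
    qed
    ultimately show ?thesis
      using bij_betw_cong by blast
  qed
  moreover have "l (partner v) = l v" if v: "v \<in> V" for v
  proof (cases "v \<in> \<rho> v \<and> partner v \<in> \<rho> v")
    case True
    then have "partner v = v"
      using \<rho>[of v] cls_eq[OF v] cls_eq[OF partner(1)[OF v]] partner_eq_self[OF v]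
      by (metis cls_def insertI1)
    then show ?thesis by simp
  next
    case False
    have "v \<in> cls v" "partner v \<in> cls (partner v)"
      by (simp_all add: cls_def)
    then have "v \<in> \<rho> v \<and> partner v \<notin> \<rho> v \<or> v \<notin> \<rho> v \<and> partner v \<in> \<rho> v"
      using False \<rho>[of v] by auto
    then show ?thesis
      using partner_partner[OF v] \<rho>_partner[OF v] by (auto simp: l_def)
  qed
  ultimately show ?thesis by blast
qed

text \<open>The layers are the classes, and \<open>\<sigma>\<close> maps a class to its image under
  \<open>partner\<close>.\<close>

lemma ex_layering:
  obtains \<sigma> and f :: "'v \<Rightarrow> 'v set \<times> nat" where
    "involution_on (cls ` V) \<sigma>" "bij_betw f V (cls ` V \<times> {..<a})"
    "\<And>u v. u \<in> V \<Longrightarrow> v \<in> V \<Longrightarrow> v \<in> N u \<longleftrightarrow> fst (f v) = \<sigma> (fst (f u)) \<and> snd (f v) \<noteq> snd (f u)"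
proof -
  obtain l where l: "\<And>v. v \<in> V \<Longrightarrow> bij_betw l (cls v) {..<a}"
    "\<And>v. v \<in> V \<Longrightarrow> l (partner v) = l v"
    using ex_labelling by blast
  have self: "v \<in> cls v" for v
    by (simp add: cls_def)
  let ?f = "\<lambda>v. (cls v, l v)"
  have "involution_on (cls ` V) ((`) partner)"
    unfolding involution_on_def
    by (auto simp del: image_image simp: cls_partner[symmetric] partner(1) partner_partner)
  moreover have "bij_betw ?f V (cls ` V \<times> {..<a})"
  proof (rule bij_betw_imageI)
    show "inj_on ?f V"
    proof (rule inj_onI)
      fix u v assume uv: "u \<in> V" "v \<in> V" "?f u = ?f v"
      then have "u \<in> cls v"
        using self[of u] by simp
      then show "u = v"
        using l(1)[OF uv(2)] uv(3) self[of v] unfolding bij_betw_def inj_on_def by blast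
    qed
    show "?f ` V = cls ` V \<times> {..<a}"
    proof (intro equalityI subsetI)
      fix p assume "p \<in> cls ` V \<times> {..<a}"
      then obtain v x where v: "p = (cls v, x)" "v \<in> V" "x < a" by blast
      then have "x \<in> l ` cls v"
        using l(1)[OF v(2)] by (simp add: bij_betw_def)
      then obtain u where u: "u \<in> cls v" "l u = x" by blast
      then have "p = ?f u" "u \<in> V"
        using v(1) cls_eq[OF v(2) u(1)] cls_subset[OF v(2)] by auto
      then show "p \<in> ?f ` V" by blast
    next
      fix p assume "p \<in> ?f ` V"
      then obtain v where v: "p = ?f v" "v \<in> V" by blast
      moreover have "l v \<in> {..<a}"
        using l(1)[OF v(2)] self[of v] by (rule bij_betw_apply)
      ultimately show "p \<in> cls ` V \<times> {..<a}" by blast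
    qed
  qed
  moreover have "v \<in> N u \<longleftrightarrow> cls v = partner ` cls u \<and> l v \<noteq> l u" if uv: "u \<in> V" "v \<in> V" for u v
  proof -
    \<comment> \<open>Labels are injective on a class, so the condition
      \<open>v \<noteq> partner u\<close> of \<open>mem_N_iff\<close> can be read off the
      labels.\<close>
    have "v = partner u \<longleftrightarrow> l v = l (partner u)" if "cls v = cls (partner u)"
      using l(1)[OF uv(2)] that self[of v] self[of "partner u"]
      unfolding bij_betw_def inj_on_def by metis
    then show ?thesis
      using mem_N_iff[OF uv] cls_partner[OF uv(1)] l(2)[OF uv(1)] by metis
  qed
  ultimately show thesis
    using that[of "(`) partner" ?f] by simp
qed

end

section \<open>From the counts to a layering, and the classification\<close>

lemma ex_layered_if_counts:
  fixes G :: "'v pair_pre_digraph"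
  assumes "pair_graph G" "a \<ge> 4" "card (pverts G) = r * a"
    and "\<And>i. i > 0 \<Longrightarrow> card (nondominating G i) = (if i < a then r * (a choose i) else 0)"
  obtains I :: "'v set set" and \<sigma> f where
    "finite I" "card I = r" "involution_on I \<sigma>" "layered G I \<sigma> a f"
proof -
  interpret G: neighbourhood_system "pverts G" "co_nbhd G" a r
  proof
    show "v \<in> co_nbhd G u" if "u \<in> pverts G" "v \<in> pverts G" "u \<in> co_nbhd G v" for u v
      using that assms(1) unfolding pair_graph_iff mem_co_nbhd by (meson symD)
  qed (use assms in \<open>auto simp: mem_co_nbhd nondominating_def pair_graph_iff\<close>)
  obtain \<sigma> f where f: "involution_on (G.cls ` pverts G) \<sigma>" "layered G (G.cls ` pverts G) \<sigma> a f"
    using G.ex_layering unfolding layered_def by metis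
  moreover have "card (G.cls ` pverts G) = r"
    using card_verts_layered[OF f(2)] assms(2,3) by simp
  ultimately show thesis
    using that G.fin by blast
qed

theorem theorem1p5:
  fixes r a :: nat and H :: "'v pair_pre_digraph"
  assumes "r \<ge> 2" and "a \<ge> r + 2" and "pair_graph H"
  shows "domination_poly H = domination_poly (\<K> r a)
    \<longleftrightarrow> (\<exists>t \<le> r div 2. H \<simeq>\<^sub>G J r a t)"
proof
  have K: "involution_on {..<r} id"
    by (simp add: involution_on_def)
  assume "domination_poly H = domination_poly (\<K> r a)"
  then have "card (pverts H) = card (pverts (\<K> r a))"
    "\<And>i. i > 0 \<Longrightarrow> card (nondominating H i) = card (nondominating (\<K> r a) i)"
    unfolding domination_poly_eq_iff_nondominating[OF assms(3) pair_graph_complete_multipartite]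
    by blast+
  then have "card (pverts H) = r * a"
    "\<And>i. i > 0 \<Longrightarrow> card (nondominating H i) = (if i < a then r * (a choose i) else 0)"
    using card_verts_layered[OF layered_complete_multipartite[of r a]]
      card_nondominating_layered[OF layered_complete_multipartite K] by simp_all
  moreover have "a \<ge> 4"
    using assms(1,2) by simp
  ultimately obtain I :: "'v set set" and \<sigma> f where
    I: "finite I" "card I = r" "involution_on I \<sigma>" "layered H I \<sigma> a f"
    using ex_layered_if_counts[OF assms(3)] by blast
  \<comment> \<open>Here \<open>t\<close> is the number of pairs of layers that
    \<open>\<sigma>\<close> swaps.\<close>
  obtain t b where "t \<le> r div 2" "bij_betw b I (J_layers r t)" "\<And>i. i \<in> I \<Longrightarrow> b (\<sigma> i) = J_swap (b i)"
    using involution_conjugate_J_swap[OF I(1,3)] unfolding I(2) by blast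
  then show "\<exists>t\<le>r div 2. H \<simeq>\<^sub>G J r a t"
    using iso_if_layered[OF assms(3) I(4,3) pair_graph_J layered_J] by blast
next
  assume "\<exists>t\<le>r div 2. H \<simeq>\<^sub>G J r a t"
  then obtain t g where t: "t \<le> r div 2" "layered H (J_layers r t) J_swap a g"
    using layered_iso[OF assms(3) pair_graph_J _ layered_J] by metis
  \<comment> \<open>Both graphs have \<open>r\<close> layers of size \<open>a\<close>, and the
    polynomial does not see the involution.\<close>
  show "domination_poly H = domination_poly (\<K> r a)"
    by (rule domination_poly_eq_if_layered[OF assms(3) t(2) involution_on_J_swap finite_J_layers
          pair_graph_complete_multipartite layered_complete_multipartite])
      (simp_all add: involution_on_def card_J_layers t(1))
qed

end
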